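(* Let $I=[0,1]$ and $\mathbb{T}^1=\mathbb{R}/\mathbb{Z}$. There exists a skew product map of the form $$f: I\times\mathbb{T}^1\to I\times\mathbb{T}^1,\qquad f(x,y)=(\tau(x),\,y+\beta(x)+\rho),$$ where - $\rho\in\mathbb{R}\setminus\mathbb{Q}$, - $\tau$ is a diffeomorphism of $I$ with exactly two fixed points, at $0$ and $1$, - $\beta:I\to\mathbb{T}^1$ is a differentiable function with $\beta|_{\{0\}\cup B_\varepsilon(1)}=0$ for some $\varepsilon>0$, such that $f$ satisfies $\underline{h}_{\mathrm{mod}}(f)\geq 1/2$.
   Context: $B_\varepsilon(1)$ denotes the $\varepsilon$-ball around $1$ in $I$. The space $I\times\mathbb{T}^1$ carries the usual product metric (for instance the maximum of the distances in the two coordinates, with the canonical distance on $\mathbb{T}^1$). For a continuous map $f:X\to X$ on a compact metric space $(X,d)$ and $n\in\mathbb{N}$, $n\ge 1$, the Hamming metric is $\hat d_n^f(x,y)=\frac1n\sum_{i=0}^{n-1}d(f^i(x),f^i(y))$. A set $S\subseteq X$ is $\delta$-separated with respect to $\hat d_n^f$ if $\hat d_n^f(x,y)\geq\delta$ for all $x\neq y$ in $S$, and $\hat S_n(f,\delta)$ denotes the maximal cardinality of such a set. The lower modified power entropy of $f$ is $$\underline{h}_{\mathrm{mod}}(f)=\lim_{\delta\to0}\liminf_{n\to\infty}\frac{\log\hat S_n(f,\delta)}{\log n}.$$ *)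

theory Defs
  imports "HOL-Analysis.Analysis"
begin

section \<open>The circle \<open>\<real>/\<int>\<close>\<close>

quotient_type circle = real / "\<lambda>a b :: real. a - b \<in> \<int>"
  morphisms rep_circle circle_of
proof (rule equivpI)
  show "reflp (\<lambda>a b :: real. a - b \<in> \<int>)" by (simp add: reflp_def)
  show "symp (\<lambda>a b :: real. a - b \<in> \<int>)"
  proof (rule sympI)
    fix a b :: real
    assume "a - b \<in> \<int>"
    then have "- (a - b) \<in> \<int>" by (rule Ints_minus)
    then show "b - a \<in> \<int>" by simp
  qed
  show "transp (\<lambda>a b :: real. a - b \<in> \<int>)"
  proof (rule transpI)
    fix a b c :: real
    assume "a - b \<in> \<int>" "b - c \<in> \<int>"
    then have "(a - b) + (b - c) \<in> \<int>" by (rule Ints_add)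
    then show "a - c \<in> \<int>" by simp
  qed
qed

instantiation circle :: ab_group_add
begin

lift_definition zero_circle :: circle is 0 .

lift_definition plus_circle :: "circle \<Rightarrow> circle \<Rightarrow> circle" is "(+)"
proof -
  fix a b c d :: real
  assume "a - b \<in> \<int>" "c - d \<in> \<int>"
  then have "(a - b) + (c - d) \<in> \<int>" by (rule Ints_add)
  then show "(a + c) - (b + d) \<in> \<int>" by (simp add: algebra_simps)
qed

lift_definition uminus_circle :: "circle \<Rightarrow> circle" is uminus
proof -
  fix a b :: real
  assume "a - b \<in> \<int>"
  then have "- (a - b) \<in> \<int>" by (rule Ints_minus)
  then show "- a - - b \<in> \<int>" by (simp add: algebra_simps)
qed

lift_definition minus_circle :: "circle \<Rightarrow> circle \<Rightarrow> circle" is "(-)"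
proof -
  fix a b c d :: real
  assume "a - b \<in> \<int>" "c - d \<in> \<int>"
  then have "(a - b) - (c - d) \<in> \<int>" by (rule Ints_diff)
  then show "(a - c) - (b - d) \<in> \<int>" by (simp add: algebra_simps)
qed

instance
proof
  fix a b c :: circle
  show "a + b + c = a + (b + c)" by transfer simp
  show "a + b = b + a" by transfer simp
  show "0 + a = a" by transfer simp
  show "- a + a = 0" by transfer simp
  show "a - b = a + - b" by transfer simp
qed

end

text \<open>Distance of a real number to the nearest integer; the infimum is attained.\<close>

definition dist_Ints :: "real \<Rightarrow> real" where
  "dist_Ints t = (INF k :: int. \<bar>t - of_int k\<bar>)"

lemma dist_Ints_le: "dist_Ints t \<le> \<bar>t - of_int k\<bar>"
  unfolding dist_Ints_def by (rule cINF_lower) (auto intro!: bdd_belowI[of _ 0])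

lemma dist_Ints_eq_round: "dist_Ints t = \<bar>t - of_int (round t)\<bar>"
proof (rule antisym)
  show "\<bar>t - of_int (round t)\<bar> \<le> dist_Ints t"
    unfolding dist_Ints_def by (rule cINF_greatest) (auto simp: round_diff_minimal)
qed (rule dist_Ints_le)

lemma dist_Ints_uminus: "dist_Ints (- t) = dist_Ints t"
proof -
  have "dist_Ints (- s) \<le> dist_Ints s" for s
    using dist_Ints_le[of "- s" "- round s"] by (simp add: dist_Ints_eq_round[of s])
  from this[of t] this[of "- t"] show ?thesis by simp
qed

lemma dist_Ints_triangle: "dist_Ints (s + t) \<le> dist_Ints s + dist_Ints t"
  using dist_Ints_le[of "s + t" "round s + round t"]
  by (simp add: dist_Ints_eq_round[of s] dist_Ints_eq_round[of t])

lemma dist_Ints_eq_0_iff: "dist_Ints t = 0 \<longleftrightarrow> t \<in> \<int>"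
proof
  assume "dist_Ints t = 0"
  then have "t = of_int (round t)" by (simp add: dist_Ints_eq_round)
  then show "t \<in> \<int>" by (metis Ints_of_int)
next
  assume "t \<in> \<int>"
  then show "dist_Ints t = 0" by (auto simp: dist_Ints_eq_round elim: Ints_cases)
qed

lemma dist_Ints_cong:
  assumes "s - t \<in> \<int>"
  shows "dist_Ints s = dist_Ints t"
proof -
  have le: "dist_Ints a \<le> dist_Ints b" if "a - b \<in> \<int>" for a b
  proof -
    have "dist_Ints (a - b) = 0" using that by (simp only: dist_Ints_eq_0_iff)
    then show ?thesis using dist_Ints_triangle[of "a - b" b] by simp
  qed
  have "t - s \<in> \<int>" using Ints_minus[OF assms] by simp
  then show ?thesis using le[OF assms] le[of t s] by simp
qed

instantiation circle :: metric_space
begin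

lift_definition dist_circle :: "circle \<Rightarrow> circle \<Rightarrow> real" is "\<lambda>a b. dist_Ints (a - b)"
proof -
  fix a b c d :: real
  assume "a - b \<in> \<int>" "c - d \<in> \<int>"
  then have "(a - b) - (c - d) \<in> \<int>" by (rule Ints_diff)
  then show "dist_Ints (a - c) = dist_Ints (b - d)"
    by (intro dist_Ints_cong) (simp add: algebra_simps)
qed

definition uniformity_circle :: "(circle \<times> circle) filter" where
  "uniformity_circle = (INF e\<in>{0<..}. principal {(x, y). dist x y < e})"

definition open_circle :: "circle set \<Rightarrow> bool" where
  "open_circle U \<longleftrightarrow> (\<forall>x\<in>U. eventually (\<lambda>(x', y). x' = x \<longrightarrow> y \<in> U) uniformity)"

instance
proof
  fix x y z :: circle
  show "dist x y = 0 \<longleftrightarrow> x = y"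
    by transfer (rule dist_Ints_eq_0_iff)
  show "dist x y \<le> dist x z + dist y z"
  proof transfer
    fix a b c :: real
    show "dist_Ints (a - b) \<le> dist_Ints (a - c) + dist_Ints (b - c)"
      using dist_Ints_triangle[of "a - c" "c - b"] dist_Ints_uminus[of "b - c"] by simp
  qed
qed (simp_all add: uniformity_circle_def open_circle_def)

end

text \<open>Differentiability of circle-valued maps. The local inverses of the covering map
  \<^const>\<open>circle_of\<close> are the charts of \<open>\<real>/\<int>\<close>, so being differentiable means having, locally, a
  differentiable lift to \<open>\<real>\<close>.\<close>

definition circle_differentiable_on :: "(real \<Rightarrow> circle) \<Rightarrow> real set \<Rightarrow> bool" where
  "circle_differentiable_on \<beta> S \<longleftrightarrow>
     (\<forall>x\<in>S. \<exists>U b. open U \<and> x \<in> U \<and> (\<forall>y\<in>S \<inter> U. \<beta> y = circle_of (b y)) \<and>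
       b differentiable (at x within S))"


section \<open>Diffeomorphisms of a subset of the line\<close>

text \<open>\<^const>\<open>C1_differentiable_on\<close> is not used here, as it demands two-sided derivatives at the
  boundary points of \<open>S\<close>.\<close>

definition C1_on :: "(real \<Rightarrow> real) \<Rightarrow> real set \<Rightarrow> bool" where
  "C1_on g S \<longleftrightarrow>
     (\<exists>g'. (\<forall>x\<in>S. (g has_real_derivative g' x) (at x within S)) \<and> continuous_on S g')"

definition diffeomorphism_on :: "real set \<Rightarrow> (real \<Rightarrow> real) \<Rightarrow> bool" where
  "diffeomorphism_on S g \<longleftrightarrow> bij_betw g S S \<and> C1_on g S \<and> C1_on (inv_into S g) S"


section \<open>Lower modified power entropy\<close>

text \<open>The metric is an explicit argument, because the type class metric of a product type is the
  Euclidean one.\<close>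

definition hamming_dist :: "('a \<Rightarrow> 'a \<Rightarrow> real) \<Rightarrow> ('a \<Rightarrow> 'a) \<Rightarrow> nat \<Rightarrow> 'a \<Rightarrow> 'a \<Rightarrow> real" where
  "hamming_dist d f n x y = (1 / real n) * (\<Sum>i<n. d ((f ^^ i) x) ((f ^^ i) y))"

definition hamming_separated ::
    "('a \<Rightarrow> 'a \<Rightarrow> real) \<Rightarrow> ('a \<Rightarrow> 'a) \<Rightarrow> nat \<Rightarrow> real \<Rightarrow> 'a set \<Rightarrow> bool" where
  "hamming_separated d f n \<delta> S \<longleftrightarrow> (\<forall>x\<in>S. \<forall>y\<in>S. x \<noteq> y \<longrightarrow> hamming_dist d f n x y \<ge> \<delta>)"

text \<open>The maximum exists for \<open>n \<ge> 1\<close> and \<open>\<delta> > 0\<close> if \<open>(X, d)\<close> is a compact metric space and \<open>f\<close> a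
  continuous self-map of \<open>X\<close>.\<close>

definition hamming_sep_card ::
    "'a set \<Rightarrow> ('a \<Rightarrow> 'a \<Rightarrow> real) \<Rightarrow> ('a \<Rightarrow> 'a) \<Rightarrow> nat \<Rightarrow> real \<Rightarrow> nat" where
  "hamming_sep_card X d f n \<delta> = Max {card S | S. S \<subseteq> X \<and> finite S \<and> hamming_separated d f n \<delta> S}"

text \<open>In the same situation the lower limit is antimonotone in \<open>\<delta>\<close>, so the limit exists in the
  extended reals.\<close>

definition lower_modified_power_entropy ::
    "'a set \<Rightarrow> ('a \<Rightarrow> 'a \<Rightarrow> real) \<Rightarrow> ('a \<Rightarrow> 'a) \<Rightarrow> ereal" where
  "lower_modified_power_entropy X d f =
     Lim (at_right 0)
       (\<lambda>\<delta>. liminf (\<lambda>n. ereal (ln (real (hamming_sep_card X d f n \<delta>)) / ln (real n))))"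


section \<open>Skew products over the unit interval\<close>

definition max_dist :: "('a::metric_space \<times> 'b::metric_space) \<Rightarrow> 'a \<times> 'b \<Rightarrow> real" where
  "max_dist p q = max (dist (fst p) (fst q)) (dist (snd p) (snd q))"

definition skew_product ::
    "(real \<Rightarrow> real) \<Rightarrow> (real \<Rightarrow> circle) \<Rightarrow> real \<Rightarrow> real \<times> circle \<Rightarrow> real \<times> circle" where
  "skew_product \<tau> \<beta> \<rho> = (\<lambda>(x, y). (\<tau> x, y + \<beta> x + circle_of \<rho>))"

end

theory Submission
  imports Defs
begin

text \<open>Take \<open>\<tau>\<close> moving points towards \<open>0\<close> so slowly that \<open>t = 1 / x\<^sup>4\<close> increases by \<open>1\<close> at each step
  near \<open>0\<close>, and \<open>\<beta> x = x\<^sup>2 (1 - cos (2 \<pi> / x\<^sup>4))\<close> there. Then \<open>\<beta>\<close> is differentiable at \<open>0\<close>, while along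
  an orbit it is a \<open>\<tau>\<close>-invariant function times \<open>t\<^sub>k\<^bsup>-1/2\<^esup>\<close>. For two starting points with distance
  \<open>\<Delta>\<close> in the coordinate \<open>t\<close>, the fibre coordinates therefore drift apart with speed comparable to
  \<open>\<Delta> / \<surd>n\<close> at times between \<open>n / 2\<close> and \<open>n\<close>. If \<open>\<Delta> \<ge> 1 / \<surd>n\<close>, the difference winds around
  the circle regularly enough for the Hamming distance to be at least \<open>1 / 64\<close>. A fixed interval of
  starting points contains about \<open>\<surd>n\<close> points with these gaps.\<close>

section \<open>Hamming separation on compact spaces\<close>

instance circle :: topological_ab_group_add
proof
  fix a b :: circle
  have le: "dist (x + y) (x' + y') \<le> dist x x' + dist y y'" for x x' y y' :: circle
  proof transfer
    fix x x' y y' :: real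
    show "dist_Ints (x + y - (x' + y')) \<le> dist_Ints (x - x') + dist_Ints (y - y')"
      using dist_Ints_triangle[of "x - x'" "y - y'"] by (simp add: algebra_simps)
  qed
  show "((\<lambda>p. fst p + snd p) \<longlongrightarrow> a + b) (nhds a \<times>\<^sub>F nhds b)"
  proof (rule tendstoI)
    fix e :: real assume "e > 0"
    then have "\<forall>\<^sub>F x in nhds a. dist x a < e / 2" "\<forall>\<^sub>F y in nhds b. dist y b < e / 2"
      by (auto simp: eventually_nhds_metric intro!: exI[of _ "e / 2"])
    then have "\<forall>\<^sub>F p in nhds a \<times>\<^sub>F nhds b. dist (fst p) a < e / 2 \<and> dist (snd p) b < e / 2"
      by (rule eventually_prodI)
    then show "\<forall>\<^sub>F p in nhds a \<times>\<^sub>F nhds b. dist (fst p + snd p) (a + b) < e"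
    proof eventually_elim
      case (elim p)
      then show ?case using le[of "fst p" "snd p" a b] by linarith
    qed
  qed
  have minus: "dist (- x) (- y) = dist x y" for x y :: circle
  proof transfer
    fix x y :: real
    show "dist_Ints (- x - - y) = dist_Ints (x - y)"
      using dist_Ints_uminus[of "x - y"] by (simp add: algebra_simps)
  qed
  show "(uminus \<longlongrightarrow> - a) (nhds a)"
    by (rule tendstoI) (auto simp: minus eventually_nhds_metric)
qed

lemma circle_of_add: "circle_of (a + b) = circle_of a + circle_of b"
  by transfer simp

lemma dist_circle_of: "dist (circle_of a) (circle_of b) = dist_Ints (a - b)"
  by transfer simp

lemma dist_Ints_le_abs: "dist_Ints t \<le> \<bar>t\<bar>"
  using dist_Ints_le[of t 0] by simp

lemma dist_Ints_nonneg: "0 \<le> dist_Ints t"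
  by (simp add: dist_Ints_eq_round)

lemma dist_Ints_ge_quarter:
  assumes "1/4 \<le> t" "t \<le> 3/4"
  shows "1/4 \<le> dist_Ints t"
proof -
  have "1/4 \<le> \<bar>t - of_int k\<bar>" for k :: int
    using assms by (cases "k \<le> 0") (auto simp: abs_if not_le dest: of_int_le_iff[where 'a=real, THEN iffD2])
  then show ?thesis by (simp add: dist_Ints_eq_round)
qed

lemma continuous_on_circle_of [continuous_intros]:
  assumes "continuous_on S g"
  shows "continuous_on S (\<lambda>x. circle_of (g x))"
proof -
  have "continuous_on UNIV circle_of"
    unfolding continuous_on_iff
    by (auto simp: dist_circle_of dist_real_def intro: le_less_trans[OF dist_Ints_le_abs])
  from continuous_on_compose2[OF this assms] show ?thesis by simp
qed

lemma compact_UNIV_circle: "compact (UNIV :: circle set)"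
proof -
  have "y \<in> circle_of ` {0..1}" for y
  proof -
    obtain r where "y = circle_of r" by (metis Quotient3_abs_rep Quotient3_circle)
    also have "circle_of r = circle_of (frac r)"
      by transfer (simp add: frac_def)
    finally show ?thesis using frac_ge_0[of r] frac_lt_1[of r] by auto
  qed
  then have "(UNIV :: circle set) = circle_of ` {0..1}" by auto
  then show ?thesis
    using compact_continuous_image[OF continuous_on_circle_of[OF continuous_on_id] compact_Icc, of 0 1]
    by simp
qed

section \<open>Maximal separated sets and the limit over scales\<close>

lemma max_dist_le_dist: "max_dist p q \<le> dist p q"
  by (auto simp: max_dist_def dist_fst_le dist_snd_le)

lemma max_dist_commute: "max_dist p q = max_dist q p"
  by (simp add: max_dist_def dist_commute)

lemma hamming_dist_commute: "hamming_dist max_dist f n p q = hamming_dist max_dist f n q p"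
  unfolding hamming_dist_def by (subst max_dist_commute) (rule refl)

text \<open>Uniform continuity of the first \<open>n\<close> iterates makes sufficiently close
  points Hamming-close, so a separated set injects into the centres of a finite cover. Hence the
  \<open>Max\<close> in \<open>hamming_sep_card\<close> is over a finite set. Compactness refers to
  the type class metric, which dominates \<open>d\<close>.\<close>

lemma bounded_hamming_separated:
  assumes X: "compact X" and f: "continuous_on X f" "f ` X \<subseteq> X"
    and d: "\<And>p q. d p q \<le> dist p q" and \<delta>: "\<delta> > 0"
  shows "finite {card S | S. S \<subseteq> X \<and> finite S \<and> hamming_separated d f n \<delta> S}"
proof -
  have "(f ^^ i) ` X \<subseteq> X \<and> continuous_on X (f ^^ i)" for i
  proof (induction i)
    case (Suc i)
    then show ?case
      using f continuous_on_compose[of X "f ^^ i" f] continuous_on_subset by fastforce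
  qed auto
  then have "uniformly_continuous_on X (f ^^ i)" for i
    using X compact_uniformly_continuous by blast
  then have "\<forall>i. \<exists>e>0. \<forall>p\<in>X. \<forall>q\<in>X. dist q p < e \<longrightarrow> dist ((f ^^ i) q) ((f ^^ i) p) < \<delta>"
    using \<delta> unfolding uniformly_continuous_on_def by blast
  then obtain e where e: "\<And>i. e i > 0"
    "\<And>i p q. p \<in> X \<Longrightarrow> q \<in> X \<Longrightarrow> dist q p < e i \<Longrightarrow> dist ((f ^^ i) q) ((f ^^ i) p) < \<delta>"
    by metis
  \<comment> \<open>The extra element 1 keeps the set under \<open>Min\<close> nonempty when
    \<open>n = 0\<close>.\<close>
  define \<eta> where "\<eta> = Min (insert 1 (e ` {..<n}))"
  have \<eta>: "\<eta> > 0" "\<And>i. i < n \<Longrightarrow> \<eta> \<le> e i" unfolding \<eta>_def using e(1) by auto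
  have close: "hamming_dist d f n q p < \<delta>" if "p \<in> X" "q \<in> X" "dist q p < \<eta>" for p q
  proof (cases "n = 0")
    case False
    have "(\<Sum>i<n. d ((f ^^ i) q) ((f ^^ i) p)) < (\<Sum>i<n. \<delta>)"
      using False that \<eta>(2) by (intro sum_strict_mono) (force intro: le_less_trans[OF d] e(2))+
    then show ?thesis using False by (simp add: hamming_dist_def field_simps)
  qed (use \<delta> in \<open>simp add: hamming_dist_def\<close>)
  obtain C where C: "finite C" "X \<subseteq> (\<Union>x\<in>C. ball x (\<eta> / 2))"
    using X \<eta>(1) unfolding compact_eq_totally_bounded by (metis half_gt_zero)
  then obtain c where c: "\<And>x. x \<in> X \<Longrightarrow> c x \<in> C \<and> dist (c x) x < \<eta> / 2"
    unfolding subset_iff UN_iff mem_ball by metis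
  have "card S \<le> card C" if S: "S \<subseteq> X" "hamming_separated d f n \<delta> S" for S
  proof (rule card_inj_on_le[OF _ _ C(1)])
    show "c ` S \<subseteq> C" using c S by auto
    show "inj_on c S"
    proof (rule inj_onI, rule ccontr)
      fix x y assume xy: "x \<in> S" "y \<in> S" "c x = c y" "x \<noteq> y"
      then have "dist x y < \<eta>"
        using c[of x] c[of y] S dist_triangle_half_r[of "c x" x \<eta> y] by auto
      then have "hamming_dist d f n x y < \<delta>" using close xy S by blast
      then show False using S xy unfolding hamming_separated_def by force
    qed
  qed
  then have "{card S | S. S \<subseteq> X \<and> finite S \<and> hamming_separated d f n \<delta> S} \<subseteq> {..card C}"
    by blast
  then show ?thesis by (rule finite_subset) simp
qed

lemma hamming_sep_card_ge:
  assumes "finite {card S | S. S \<subseteq> X \<and> finite S \<and> hamming_separated d f n \<delta> S}"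
    "S \<subseteq> X" "finite S" "hamming_separated d f n \<delta> S"
  shows "card S \<le> hamming_sep_card X d f n \<delta>"
  unfolding hamming_sep_card_def using assms by (intro Max_ge) auto

text \<open>An antitone function converges from the right to its supremum, which always exists in
  \<open>ereal\<close>; so \<open>Lim\<close> denotes a genuine limit.\<close>

lemma antimono_le_Lim_at_right:
  fixes g :: "real \<Rightarrow> ereal"
  assumes g: "\<And>r s. a < r \<Longrightarrow> r \<le> s \<Longrightarrow> g s \<le> g r" and "a < r"
  shows "g r \<le> Lim (at_right a) g"
proof -
  have "(g \<longlongrightarrow> (SUP r\<in>{a<..}. g r)) (at_right a)"
  proof (rule order_tendstoI)
    fix l assume "l < (SUP r\<in>{a<..}. g r)"
    then obtain s where s: "a < s" "l < g s" by (auto simp: less_SUP_iff)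
    have "\<forall>\<^sub>F x in at_right a. x \<in> {a<..<s}" by (rule eventually_at_right_real[OF s(1)])
    then show "\<forall>\<^sub>F x in at_right a. l < g x"
      by eventually_elim (use s g in \<open>fastforce intro: less_le_trans\<close>)
  next
    fix u assume u: "(SUP r\<in>{a<..}. g r) < u"
    have "\<forall>\<^sub>F x in at_right a. x \<in> {a<..<a+1}" by (rule eventually_at_right_real) simp
    then show "\<forall>\<^sub>F x in at_right a. g x < u"
      by eventually_elim (use u in \<open>auto intro: le_less_trans[OF SUP_upper]\<close>)
  qed
  then have "Lim (at_right a) g = (SUP r\<in>{a<..}. g r)"
    by (intro tendsto_Lim) auto
  then show ?thesis using \<open>a < r\<close> by (auto intro: SUP_upper)
qed

text \<open>Reduces an entropy bound to a single scale: a smaller \<delta> admits more separated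
  sets, so the lower limit is antitone in \<delta>.\<close>

lemma liminf_le_lower_modified_power_entropy:
  assumes X: "compact X" "X \<noteq> {}" and f: "continuous_on X f" "f ` X \<subseteq> X"
    and d: "\<And>p q. d p q \<le> dist p q" and "\<delta> > 0"
  shows "liminf (\<lambda>n. ereal (ln (real (hamming_sep_card X d f n \<delta>)) / ln (real n)))
    \<le> lower_modified_power_entropy X d f"
  unfolding lower_modified_power_entropy_def
proof (rule antimono_le_Lim_at_right[OF _ \<open>\<delta> > 0\<close>])
  fix r s :: real assume rs: "0 < r" "r \<le> s"
  have fin: "finite {card S | S. S \<subseteq> X \<and> finite S \<and> hamming_separated d f n t S}" if "t > 0" for n t
    using bounded_hamming_separated[OF X(1) f d that] .
  have le: "hamming_sep_card X d f n s \<le> hamming_sep_card X d f n r" for n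
    unfolding hamming_sep_card_def
  proof (rule Max_mono)
    show "{card S | S. S \<subseteq> X \<and> finite S \<and> hamming_separated d f n s S} \<subseteq>
        {card S | S. S \<subseteq> X \<and> finite S \<and> hamming_separated d f n r S}"
      using rs unfolding hamming_separated_def by force
    show "{card S | S. S \<subseteq> X \<and> finite S \<and> hamming_separated d f n s S} \<noteq> {}"
      by (auto intro!: exI[of _ "{}"] simp: hamming_separated_def)
  qed (use fin rs in auto)
  obtain x where x: "x \<in> X" using X by blast
  \<comment> \<open>Singletons are separated, so the counts stay where \<open>ln\<close> is
    monotone.\<close>
  have pos: "1 \<le> hamming_sep_card X d f n s" for n
    using hamming_sep_card_ge[OF fin, of s "{x}" n] x rs by (simp add: hamming_separated_def)
  have "ln (real (hamming_sep_card X d f n s)) / ln (real n)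
      \<le> ln (real (hamming_sep_card X d f n r)) / ln (real n)" for n
    using le[of n] pos[of n]
    by (cases "n = 0") (auto intro!: divide_right_mono)
  then show "liminf (\<lambda>n. ereal (ln (real (hamming_sep_card X d f n s)) / ln (real n)))
      \<le> liminf (\<lambda>n. ereal (ln (real (hamming_sep_card X d f n r)) / ln (real n)))"
    by (intro Liminf_mono always_eventually) auto
qed

section \<open>The base map and the cocycle\<close>

text \<open>A positive derivative in the interior gives strict monotonicity, the fixed endpoints and
  the intermediate value theorem give surjectivity, and the inverse has the continuous derivative
  \<open>inverse (g' (?h x))\<close>.\<close>

lemma diffeomorphism_on_intervalI:
  fixes g :: "real \<Rightarrow> real"
  assumes ab: "a \<le> b" "g a = a" "g b = b"
    and g: "\<And>x. x \<in> {a..b} \<Longrightarrow> (g has_real_derivative g' x) (at x within {a..b})"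
    and g': "continuous_on {a..b} g'" "\<And>x. x \<in> {a..b} \<Longrightarrow> g' x > 0"
  shows "diffeomorphism_on {a..b} g"
proof -
  have cont: "continuous_on {a..b} g" by (rule DERIV_continuous_on) (rule g)
  have mono: "g x < g y" if "x \<in> {a..b}" "y \<in> {a..b}" "x < y" for x y
  proof -
    have "(g has_real_derivative g' z) (at z) \<and> 0 < g' z" if z: "x < z" "z < y" for z
    proof -
      have "z \<in> {a..b}" "a < z" "z < b" using z \<open>x \<in> {a..b}\<close> \<open>y \<in> {a..b}\<close> by auto
      then show ?thesis using g[of z] g'(2)[of z] at_within_Icc_at[of a z b] by simp
    qed
    moreover have "continuous_on {x..y} g"
      by (rule continuous_on_subset[OF cont]) (use that in auto)
    ultimately show ?thesis
      using that(3) by (blast intro: DERIV_pos_imp_increasing_open)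
  qed
  have inj: "inj_on g {a..b}"
    using mono by (metis inj_onI linorder_neqE less_irrefl)
  have img: "g ` {a..b} = {a..b}"
  proof
    show "g ` {a..b} \<subseteq> {a..b}"
    proof clarsimp
      fix x assume "a \<le> x" "x \<le> b"
      then show "a \<le> g x \<and> g x \<le> b"
        using mono[of a x] mono[of x b] ab by (cases "x = a"; cases "x = b") auto
    qed
    show "{a..b} \<subseteq> g ` {a..b}"
      using IVT'[of g a _ b] ab cont by (auto simp: image_iff) (metis atLeastAtMost_iff)
  qed
  let ?h = "inv_into {a..b} g"
  have h: "?h x \<in> {a..b}" "g (?h x) = x" if "x \<in> {a..b}" for x
    using that img by (metis inv_into_into, metis f_inv_into_f)
  have hcont: "continuous_on {a..b} ?h"
    using continuous_on_inv[OF cont compact_Icc, of ?h] inj img by simp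
  have "(?h has_real_derivative inverse (g' (?h x))) (at x within {a..b})" if x: "x \<in> {a..b}" for x
  proof -
    have "(?h has_derivative (*) (inverse (g' (?h x)))) (at (g (?h x)) within g ` {a..b})"
      by (rule has_derivative_inverse_within[where f'="(*) (g' (?h x))"])
        (use g[OF h(1)[OF x]] h[OF x] g'(2)[OF h(1)[OF x]] hcont x img inj in
          \<open>auto simp: has_field_derivative_def continuous_on_eq_continuous_within linear_times o_def fun_eq_iff\<close>)
    then show ?thesis using h[OF x] img by (simp add: has_field_derivative_def)
  qed
  then have "C1_on ?h {a..b}"
    unfolding C1_on_def
  proof (intro exI conjI ballI)
    have "continuous_on {a..b} (\<lambda>x. g' (?h x))"
      by (rule continuous_on_compose2[OF g'(1) hcont]) (use h in auto)
    then show "continuous_on {a..b} (\<lambda>x. inverse (g' (?h x)))"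
      by (rule continuous_on_inverse) (metis g'(2) h(1) less_irrefl)
  qed
  then show ?thesis
    using g g'(1) inj img unfolding diffeomorphism_on_def C1_on_def bij_betw_def by blast
qed

section \<open>The base map\<close>

lemma DERIV_max_0_power2: "((\<lambda>y. (max 0 y)\<^sup>2) has_real_derivative 2 * max 0 y) (at y)"
proof -
  consider "y < 0" | "y > 0" | "y = 0" by linarith
  then show ?thesis
  proof cases
    case 1
    have "((\<lambda>y. 0) has_real_derivative 2 * max 0 y) (at y)" using 1 by simp
    then show ?thesis
      by (rule has_field_derivative_transform_within_open[of _ _ _ "{..<0}"]) (use 1 in auto)
  next
    case 2
    have "((\<lambda>y. y\<^sup>2) has_real_derivative 2 * max 0 y) (at y)"
      using 2 by (auto intro!: derivative_eq_intros)
    then show ?thesis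
      by (rule has_field_derivative_transform_within_open[of _ _ _ "{0<..}"]) (use 2 in auto)
  next
    case 3
    \<comment> \<open>At the corner the difference quotient is at most \<open>\<bar>h\<bar>\<close>
      in absolute value.\<close>
    have "((\<lambda>h::real. (max 0 h)\<^sup>2 / h) \<longlongrightarrow> 0) (at 0)"
      by (rule Lim_null_comparison[OF always_eventually tendsto_rabs_zero[OF tendsto_ident_at]])
        (simp add: max_def power2_eq_square)
    then show ?thesis using 3 by (simp add: DERIV_def)
  qed
qed

text \<open>In the coordinate \<open>t = 1 / x\<^sup>4\<close>, \<open>slow_map\<close> is \<open>t \<mapsto> t + 1\<close> for \<open>t \<ge> 2\<close>; the truncated
  square bends it in a \<open>C\<^sup>1\<close> way so that \<open>t = 1\<close> becomes fixed.\<close>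

definition slow_denom :: "real \<Rightarrow> real" where
  "slow_denom x = 1 + x ^ 4 - (max 0 (2 * x ^ 4 - 1))\<^sup>2"

definition slow_map :: "real \<Rightarrow> real" where
  "slow_map x = x * slow_denom x powr (- 1 / 4)"

text \<open>\<open>slow_map\<close> multiplies \<open>1 / x ^ 4\<close> by
  \<open>slow_denom x\<close>, so a factor above 1 pushes every interior point towards 0.\<close>

lemma slow_denom_gt_1:
  assumes "0 < x" "x < 1"
  shows "1 < slow_denom x"
proof -
  define u where "u = x ^ 4"
  have u: "0 < u" "u < 1" using assms unfolding u_def by (auto simp: power_less_one_iff)
  have "(2 * u - 1)\<^sup>2 < u" if "1/2 \<le> u"
  proof -
    \<comment> \<open>This product is \<open>(2 * u - 1)\<^sup>2 - u\<close>.\<close>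
    have "(4 * u - 1) * (u - 1) < 0" using that u by (intro mult_pos_neg) auto
    then show ?thesis by (simp add: power2_eq_square algebra_simps)
  qed
  then show ?thesis using u unfolding slow_denom_def u_def[symmetric] by (auto simp: max_def)
qed

lemma slow_denom_ge_1:
  assumes "x \<in> {0..1}"
  shows "1 \<le> slow_denom x"
proof -
  have "x = 0 \<or> x = 1 \<or> 0 < x \<and> x < 1" using assms by auto
  then show ?thesis using slow_denom_gt_1[of x] by (auto simp: slow_denom_def)
qed

lemma slow_map_0 [simp]: "slow_map 0 = 0"
  by (simp add: slow_map_def)

lemma slow_map_1 [simp]: "slow_map 1 = 1"
  by (simp add: slow_map_def slow_denom_def)

lemma slow_map_fixed_points: "{x \<in> {0..1}. slow_map x = x} = {0, 1}"
proof -
  have "slow_map x \<noteq> x" if "0 < x" "x < 1" for x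
  proof -
    have "slow_denom x powr (- 1 / 4) < 1 powr (- 1 / 4)"
      by (rule powr_less_mono2_neg) (use slow_denom_gt_1[OF that] in auto)
    then show ?thesis using that by (simp add: slow_map_def)
  qed
  then show ?thesis
    by (auto, metis less_eq_real_def)
qed

lemma diffeomorphism_on_slow_map: "diffeomorphism_on {0..1} slow_map"
proof (rule diffeomorphism_on_intervalI)
  define m where "m x = max 0 (2 * x ^ 4 - 1)" for x :: real
  let ?D = "\<lambda>x. slow_denom x powr (- 5 / 4) * (1 - (m x)\<^sup>2 + 4 * x ^ 4 * m x)"
  fix x :: real assume x: "x \<in> {0..1}"
  have pos: "slow_denom x > 0" using slow_denom_ge_1[OF x] by simp
  have sq: "((\<lambda>x. (m x)\<^sup>2) has_real_derivative 2 * m x * (8 * x ^ 3)) (at x)"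
    unfolding m_def
    by (rule DERIV_chain2[OF DERIV_max_0_power2]) (auto intro!: derivative_eq_intros)
  have D: "(slow_denom has_real_derivative 4 * x ^ 3 - 2 * m x * (8 * x ^ 3)) (at x)"
    unfolding slow_denom_def m_def[symmetric]
    by (intro DERIV_diff sq) (auto intro!: derivative_eq_intros)
  let ?w = "slow_denom x"
  have "(slow_map has_real_derivative ?w powr (- 1 / 4)
      + x * (- 1 / 4 * ?w powr (- 5 / 4) * (4 * x ^ 3 - 2 * m x * (8 * x ^ 3)))) (at x)"
    unfolding slow_map_def using DERIV_mult[OF DERIV_ident DERIV_fun_powr[OF D pos, of "- 1 / 4"]]
    by (simp add: algebra_simps)
  \<comment> \<open>Taking out the common power of \<open>?w\<close> leaves a polynomial factor,
    which is at least 1 because \<open>0 \<le> m x \<le> 4 * x ^ 4\<close>.\<close>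
  also have "?w powr (- 1 / 4) = ?w powr (- 5 / 4) * ?w"
    using pos powr_mult_base[of ?w "- 5 / 4"] by (simp add: mult.commute)
  also have "?w powr (- 5 / 4) * ?w
      + x * (- 1 / 4 * ?w powr (- 5 / 4) * (4 * x ^ 3 - 2 * m x * (8 * x ^ 3)))
      = ?w powr (- 5 / 4) * (?w - x ^ 4 + 4 * x ^ 4 * m x)"
    by (simp add: algebra_simps power_numeral_reduce)
  also have "?w - x ^ 4 = 1 - (m x)\<^sup>2" by (simp add: slow_denom_def m_def)
  finally show "(slow_map has_real_derivative ?D x) (at x within {0..1})"
    by (rule has_field_derivative_at_within)
  have "0 \<le> x ^ 4" by simp
  then have "m x \<le> 4 * x ^ 4" unfolding m_def by (intro max.boundedI) linarith+
  then have "0 \<le> m x * (4 * x ^ 4 - m x)" by (simp add: m_def)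
  then have "0 < 1 - (m x)\<^sup>2 + 4 * x ^ 4 * m x"
    by (simp add: algebra_simps power2_eq_square)
  then show "0 < ?D x" using pos by simp
next
  have "continuous_on {0..1} slow_denom"
    unfolding slow_denom_def by (intro continuous_intros)
  moreover have "\<forall>x\<in>{0..1}. slow_denom x \<noteq> 0" using slow_denom_ge_1 by force
  ultimately show "continuous_on {0..1} (\<lambda>x. slow_denom x powr (- 5 / 4) *
      (1 - (max 0 (2 * x ^ 4 - 1))\<^sup>2 + 4 * x ^ 4 * (max 0 (2 * x ^ 4 - 1))))"
    by (intro continuous_intros) auto
qed auto

text \<open>For \<open>t \<ge> 2\<close> the truncated square vanishes, and the factor is
  \<open>(t + 1) / t\<close>.\<close>

lemma slow_map_powr:
  assumes "2 \<le> t"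
  shows "slow_map (t powr (- 1 / 4)) = (t + 1) powr (- 1 / 4)"
proof -
  have p: "(t powr (- 1 / 4)) ^ 4 = 1 / t"
    using assms powr_power[of t "- 1 / 4" 4] by (simp add: powr_minus_divide)
  have "slow_denom (t powr (- 1 / 4)) = (t + 1) / t"
    using assms unfolding slow_denom_def p by (simp add: max_def field_simps)
  then show ?thesis using assms by (simp add: slow_map_def flip: powr_mult)
qed

section \<open>The cocycle\<close>

text \<open>The condition \<open>x ^ 4 \<le> 1 / 2\<close> cuts at a double zero of \<open>1 - cos (2 * pi / x ^ 4)\<close>.\<close>

definition oscillation :: "real \<Rightarrow> real" where
  "oscillation x = (if 0 < x \<and> x ^ 4 \<le> 1 / 2 then x\<^sup>2 * (1 - cos (2 * pi / x ^ 4)) else 0)"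

text \<open>\<open>oscillation\<close> in the coordinate \<open>t = 1 / x ^ 4\<close>. The cosine
  factor is invariant under \<open>t \<mapsto> t + 1\<close>, so only the power of \<open>t\<close>
  changes along an orbit.\<close>

definition wave :: "real \<Rightarrow> real" where
  "wave t = (1 - cos (2 * pi * t)) * t powr (- 1 / 2)"

lemma oscillation_powr:
  assumes "2 \<le> t"
  shows "oscillation (t powr (- 1 / 4)) = wave t"
proof -
  have p: "(t powr (- 1 / 4)) ^ 4 = 1 / t" "(t powr (- 1 / 4))\<^sup>2 = t powr (- 1 / 2)"
    using assms powr_power[of t "- 1 / 4" 4] powr_power[of t "- 1 / 4" 2]
    by (simp_all add: powr_minus_divide)
  show ?thesis using assms unfolding oscillation_def wave_def p by simp
qed

text \<open>The quadratic factor forces derivative 0 at the origin, although the derivative is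
  unbounded nearby. At the cut both one-sided derivatives are 0.\<close>

lemma oscillation_differentiable:
  assumes "0 \<le> a"
  shows "\<exists>D. (oscillation has_real_derivative D) (at a)"
proof -
  have z: "oscillation 0 = 0" by (simp add: oscillation_def)
  let ?g = "\<lambda>x::real. x\<^sup>2 * (1 - cos (2 * pi / x ^ 4))"
  have g: "(?g has_real_derivative 2 * x * (1 - cos (2 * pi / x ^ 4))
      - x\<^sup>2 * (sin (2 * pi / x ^ 4) * (8 * pi / x ^ 5))) (at x)" if "x > 0" for x
    using that by (auto intro!: derivative_eq_intros simp: field_simps power_numeral_reduce)
  consider "a = 0" | "a > 0" "a ^ 4 < 1 / 2" | "a > 0" "a ^ 4 = 1 / 2" | "a > 0" "a ^ 4 > 1 / 2"
    using assms by linarith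
  then show ?thesis
  proof cases
    case 1
    have "\<bar>oscillation h / h\<bar> \<le> \<bar>2 * h\<bar>" for h
    proof -
      have "\<bar>1 - cos z\<bar> \<le> 2" for z :: real using cos_ge_minus_one[of z] cos_le_one[of z] by linarith
      then have "\<bar>oscillation h\<bar> \<le> h\<^sup>2 * 2"
        by (simp add: oscillation_def abs_mult mult_left_mono)
      also have "\<dots> = \<bar>2 * h\<bar> * \<bar>h\<bar>" by (simp add: power2_eq_square abs_mult_self_eq)
      finally show ?thesis by (cases "h = 0") (simp_all add: abs_divide divide_le_eq)
    qed
    then have "((\<lambda>h. oscillation h / h) \<longlongrightarrow> 0) (at 0)"
      by (intro Lim_null_comparison[OF always_eventually
            tendsto_rabs_zero[OF tendsto_mult_right_zero[OF tendsto_ident_at]], of _ 2]) auto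
    then have "(oscillation has_real_derivative 0) (at 0)" by (simp add: DERIV_def z)
    then show ?thesis using 1 by blast
  next
    case 2
    have "open ({0<..} \<inter> {x::real. x ^ 4 < 1 / 2})"
      by (intro open_Int open_Collect_less continuous_intros) auto
    from has_field_derivative_transform_within_open[OF g[OF \<open>a > 0\<close>] this, of oscillation] 2
    show ?thesis by (fastforce simp: oscillation_def)
  next
    case 3
    have less: "x ^ 4 \<le> 1 / 2 \<longleftrightarrow> x \<le> a" if "x > 0" for x
      unfolding \<open>a ^ 4 = 1 / 2\<close>[symmetric] by (rule power_mono_iff) (use 3 that in auto)
    \<comment> \<open>The cut lies at phase \<open>4 * pi\<close>, a full number of periods.\<close>
    have "2 * pi / a ^ 4 = 2 * pi * of_int 2" unfolding \<open>a ^ 4 = 1 / 2\<close> by simp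
    then have cs: "cos (2 * pi / a ^ 4) = 1" "sin (2 * pi / a ^ 4) = 0"
      by (simp_all only: cos_int_2pin sin_int_2pin)
    then have "(?g has_real_derivative 0) (at a within {..a})" "?g a = 0"
      using g[of a] \<open>a > 0\<close> by (auto simp: cs intro: has_field_derivative_at_within)
    from this(1) have "(oscillation has_real_derivative 0) (at a within {..a})"
      by (rule has_field_derivative_transform_within[of ?g 0 a "{..a}" a])
        (use 3 less in \<open>auto simp: oscillation_def dist_real_def\<close>)
    moreover have "(oscillation has_real_derivative 0) (at a within {a..})"
      by (rule has_field_derivative_transform_within[of "\<lambda>_. 0" 0 a "{a..}" a])
        (use 3 less \<open>?g a = 0\<close> in \<open>auto simp: oscillation_def\<close>)
    moreover have "{..a} \<union> {a..} = UNIV" by auto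
    ultimately show ?thesis
      unfolding has_field_derivative_iff
      using filterlim_sup[of _ _ "at a within {..a}" "at a within {a..}"]
        at_within_union[of a "{..a}" "{a..}"] by force
  next
    case 4
    have "open ({0<..} \<inter> {x::real. x ^ 4 > 1 / 2})"
      by (intro open_Int open_Collect_less continuous_intros) auto
    from has_field_derivative_transform_within_open[OF DERIV_const this, of a 0 oscillation] 4
    show ?thesis by (fastforce simp: oscillation_def)
  qed
qed

section \<open>Separation of orbits\<close>

text \<open>Once the increments are comparable to \<open>s\<close>, there is an \<open>m\<close> for which \<open>z (i + m) - z i\<close> lies in
  \<open>[1 / 4, 3 / 4]\<close> for all late \<open>i\<close>, so \<open>z i\<close> and \<open>z (i + m)\<close> cannot both be close to integers.\<close>

lemma sum_dist_Ints_ge: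
  fixes z :: "nat \<Rightarrow> real"
  assumes s: "0 < s" "s \<le> 1 / 8" "3 \<le> 2 * s * real n" and n: "4 \<le> n"
    and step: "\<And>k. n \<le> 2 * k \<Longrightarrow> k < n \<Longrightarrow> s \<le> z (Suc k) - z k \<and> z (Suc k) - z k \<le> 2 * s"
  shows "real n / 64 \<le> (\<Sum>i<n. dist_Ints (z i))"
proof -
  \<comment> \<open>The least shift with \<open>m * s \<ge> 1 / 4\<close>. Rounding up costs at most
    \<open>s\<close>, so \<open>2 * m * s \<le> 1 / 2 + 2 * s \<le> 3 / 4\<close>.\<close>
  define m where "m = nat \<lceil>1 / (4 * s)\<rceil>"
  \<comment> \<open>Rounded up, so that \<open>step\<close> applies from index \<open>a\<close>
    on.\<close>
  define a where "a = (n + 1) div 2"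
  have "1 / (4 * s) > 0" using s by simp
  then have "1 / (4 * s) \<le> real m" "real m \<le> 1 / (4 * s) + 1" unfolding m_def by linarith+
  then have "1 \<le> 4 * s * real m" "4 * s * real m \<le> 1 + 4 * s"
    using s by (simp_all add: field_simps)
  then have ms: "1 / 4 \<le> real m * s" "real m * (2 * s) \<le> 3 / 4"
    using s by (simp_all add: algebra_simps)
  have "s * (8 * real m) = 4 * (real m * (2 * s))" by simp
  also have "\<dots> \<le> 2 * s * real n" using ms(2) s(3) by linarith
  also have "\<dots> = s * (2 * real n)" by simp
  finally have "s * (8 * real m) \<le> s * (2 * real n)" .
  then have mn: "4 * m \<le> n" using s(1) by simp
  have incr: "real j * s \<le> z (i + j) - z i \<and> z (i + j) - z i \<le> real j * (2 * s)"
    if "a \<le> i" "i + j \<le> n" for i j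
    using that(2)
  proof (induction j)
    case (Suc j)
    have "n \<le> 2 * (i + j)" using that(1) unfolding a_def by presburger
    then show ?case using Suc step[of "i + j"] by (simp add: algebra_simps)
  qed simp
  have pair: "1 / 4 \<le> dist_Ints (z i) + dist_Ints (z (i + m))" if "i \<in> {a..<n - m}" for i
  proof -
    have "a \<le> i" "i + m \<le> n" using that by auto
    then have "1 / 4 \<le> dist_Ints (z (i + m) - z i)"
      using incr[of i m] ms by (intro dist_Ints_ge_quarter) linarith+
    then show ?thesis
      using dist_Ints_triangle[of "z (i + m)" "- z i"] by (simp add: dist_Ints_uminus)
  qed
  \<comment> \<open>From \<open>4 * m \<le> n\<close> and \<open>n \<ge> 4\<close> there are at
    least \<open>n / 8\<close> pairs, each contributing \<open>1 / 4\<close>.\<close>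
  have "real n / 32 \<le> real (card {a..<n - m}) * (1 / 4)"
    using mn n unfolding a_def by simp
  also have "\<dots> \<le> (\<Sum>i = a..<n - m. dist_Ints (z i) + dist_Ints (z (i + m)))"
    by (rule sum_bounded_below) (rule pair)
  also have "\<dots> = (\<Sum>i = a..<n - m. dist_Ints (z i)) + (\<Sum>i = a + m..<n - m + m. dist_Ints (z i))"
    by (simp only: sum.distrib sum.shift_bounds_nat_ivl)
  \<comment> \<open>Each of the two ranges lies below \<open>n\<close>; counting the full sum twice
    turns 32 into 64.\<close>
  also have "\<dots> \<le> (\<Sum>i<n. dist_Ints (z i)) + (\<Sum>i<n. dist_Ints (z i))"
    using mn by (intro add_mono sum_mono2) (auto simp: dist_Ints_nonneg)
  finally show ?thesis by simp
qed

text \<open>The mean value theorem reduces both bounds to the derivative of \<open>wave\<close>,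
  dominated by its sine term. The sine varies by a factor \<open>2 / sqrt 3\<close> and
  \<open>sqrt z\<close> by about \<open>sqrt 2\<close>, which together stay below the factor 2
  allowed in \<open>sum_dist_Ints_ge\<close>.\<close>

lemma wave_diff_bounds:
  assumes t: "13 / 6 \<le> t" "t < t'" "t' \<le> 9 / 4" and n: "100 \<le> n"
    and k: "n \<le> 2 * k" "k < n"
  defines "s \<equiv> (8 / 5) * pi * (t' - t) / sqrt (real n)"
  shows "s \<le> wave (t' + real k) - wave (t + real k)"
    "wave (t' + real k) - wave (t + real k) \<le> 2 * s"
proof -
  \<comment> \<open>Between \<open>t\<close> and \<open>t'\<close> the sine of \<open>2 * pi * z\<close> stays in \<open>[sqrt 3 / 2, 1]\<close>; together with
    \<open>n / 2 \<le> k < n\<close> this keeps the derivative within a factor less than 2.\<close>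
  define D where "D z = 2 * pi * sin (2 * pi * z) * z powr (- 1 / 2)
    - (1 - cos (2 * pi * z)) * (1 / 2 * z powr (- 3 / 2))" for z :: real
  have "(wave has_real_derivative D z) (at z)" if "z > 0" for z
    unfolding wave_def D_def using that by (auto intro!: derivative_eq_intros simp: algebra_simps diff_divide_distrib)
  then obtain z where z: "t + real k < z" "z < t' + real k"
    and eq: "wave (t' + real k) - wave (t + real k) = (t' + real k - (t + real k)) * D z"
    using MVT2[of "t + real k" "t' + real k" wave D] t by force
  \<comment> \<open>The phase modulo \<open>2 * pi\<close>; the interval from \<open>13 / 6\<close>
    to \<open>9 / 4\<close> becomes \<open>pi / 3\<close> to \<open>pi / 2\<close>.\<close>
  define \<theta> where "\<theta> = 2 * pi * (z - real k - 2)"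
  have "2 * pi * z = \<theta> + 2 * pi * of_int (int k + 2)" unfolding \<theta>_def by (simp add: algebra_simps)
  then have trig: "sin (2 * pi * z) = sin \<theta>" "cos (2 * pi * z) = cos \<theta>"
    by (simp_all only: sin_add cos_add sin_int_2pin cos_int_2pin mult_1_right mult_zero_right
        add_0_right diff_zero)
  have "1 / 6 < z - real k - 2" "z - real k - 2 < 1 / 4" using z t by auto
  then have \<theta>: "pi / 3 \<le> \<theta>" "\<theta> \<le> pi / 2"
    using mult_strict_left_mono[of "1 / 6" "z - real k - 2" "2 * pi"]
      mult_strict_left_mono[of "z - real k - 2" "1 / 4" "2 * pi"] unfolding \<theta>_def by auto
  have "sin (pi / 3) \<le> sin \<theta>" using \<theta> by (intro sin_monotone_2pi_le) auto
  then have sin_ge: "sqrt 3 / 2 \<le> sin \<theta>" by (simp add: sin_60)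
  have cos_ge: "0 \<le> cos \<theta>" using \<theta> by (intro cos_ge_zero) auto
  have zn: "real n / 2 \<le> z" "z \<le> real n + 2" "50 \<le> z" using z t k n by linarith+
  have sq: "z powr (- 1 / 2) = 1 / sqrt z" "z powr (- 3 / 2) = 1 / (z * sqrt z)"
    using zn powr_mult_base[of z "1 / 2"] by (simp_all add: powr_minus_divide powr_half_sqrt)
  have Dz: "D z = (2 * pi * sin \<theta> - (1 - cos \<theta>) / (2 * z)) / sqrt z"
    unfolding D_def trig sq using zn by (simp add: field_simps)
  have "(8 / 5) * pi / sqrt n \<le> D z"
  proof -
    \<comment> \<open>As \<open>sqrt 3 \<ge> 43 / 25\<close>, the sine term is at least
      \<open>1.72 * pi\<close>, and \<open>0.02 * pi\<close> absorbs the cosine term.\<close>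
    have "(17 / 10) * pi \<le> 2 * pi * sin \<theta> - (1 - cos \<theta>) / (2 * z)"
    proof -
      have "43 / 25 \<le> sqrt 3" by (rule real_le_rsqrt) (simp add: power2_eq_square)
      then have "2 * pi * (43 / 50) \<le> 2 * pi * sin \<theta>" using sin_ge by (intro mult_left_mono) auto
      moreover have "(1 - cos \<theta>) / (2 * z) \<le> 1 / 100" using zn cos_ge by (simp add: divide_le_eq)
      ultimately show ?thesis using pi_ge_two by linarith
    qed
    moreover have "(8 / 5) * sqrt z \<le> (17 / 10) * sqrt n"
    proof -
      \<comment> \<open>The ratio 17 : 16 between \<open>17 / 10\<close> and \<open>8 / 5\<close>
        absorbs the excess of \<open>z \<le> n + 2\<close> over \<open>n\<close>.\<close>
      have "sqrt (256 * z) \<le> sqrt (289 * real n)" using zn n by (intro real_sqrt_le_mono) linarith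
      then show ?thesis by (simp add: real_sqrt_mult)
    qed
    ultimately have "pi * ((8 / 5) * sqrt z) \<le> pi * ((17 / 10) * sqrt n)"
      "(17 / 10) * pi * sqrt n \<le> (2 * pi * sin \<theta> - (1 - cos \<theta>) / (2 * z)) * sqrt n"
      by (intro mult_left_mono mult_right_mono; simp)+
    then have "(8 / 5) * pi * sqrt z \<le> (2 * pi * sin \<theta> - (1 - cos \<theta>) / (2 * z)) * sqrt n"
      by (simp only: mult_ac)
    moreover have "0 < sqrt z" "0 < sqrt (real n)" using zn n by simp_all
    moreover have "a / b \<le> c / d" if "a * d \<le> c * b" "0 < d" "0 < b" for a b c d :: real
      using that by (simp add: field_simps)
    ultimately show ?thesis unfolding Dz by blast
  qed
  then show "s \<le> wave (t' + real k) - wave (t + real k)"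
    unfolding eq s_def using t mult_left_mono[of "(8 / 5) * pi / sqrt n" "D z" "t' - t"]
    by (simp add: mult_ac)
  have "D z \<le> (16 / 5) * pi / sqrt n"
  proof -
    have "2 * pi * sin \<theta> \<le> 2 * pi * 1" by (intro mult_left_mono) auto
    moreover have "0 \<le> (1 - cos \<theta>) / (2 * z)" using zn by simp
    ultimately have "2 * pi * sin \<theta> - (1 - cos \<theta>) / (2 * z) \<le> 2 * pi" by linarith
    then have "D z \<le> 2 * pi / sqrt z" unfolding Dz using zn by (intro divide_right_mono) auto
    also have "\<dots> \<le> (16 / 5) * pi / sqrt n"
    proof -
      \<comment> \<open>Follows from \<open>z \<ge> n / 2\<close>, since
        \<open>25 \<le> 64 / 2\<close>.\<close>
      have "sqrt (25 * real n) \<le> sqrt (64 * z)" using zn by (intro real_sqrt_le_mono) linarith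
      then show ?thesis using zn n by (simp add: real_sqrt_mult field_simps)
    qed
    finally show ?thesis .
  qed
  then show "wave (t' + real k) - wave (t + real k) \<le> 2 * s"
    unfolding eq s_def using t mult_left_mono[of "D z" "(16 / 5) * pi / sqrt n" "t' - t"]
    by (simp add: mult_ac)
qed

text \<open>The gap of \<open>1 / sqrt n\<close> makes \<open>s * n\<close> at least
  \<open>16 / 5\<close>, so the difference winds far enough; \<open>t' - t \<le> 1 / 12\<close> and
  \<open>sqrt n \<ge> 10\<close> keep \<open>s\<close> small.\<close>

lemma sum_dist_Ints_wave_ge:
  assumes t: "13 / 6 \<le> t" "t' \<le> 9 / 4" "1 / sqrt (real n) \<le> t' - t" and n: "100 \<le> n"
  shows "real n / 64 \<le> (\<Sum>i<n. dist_Ints ((\<Sum>k<i. wave (t' + real k)) - (\<Sum>k<i. wave (t + real k))))"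
proof (rule sum_dist_Ints_ge)
  define s where "s = (8 / 5) * pi * (t' - t) / sqrt (real n)"
  have "sqrt 100 \<le> sqrt (real n)" using n by (intro real_sqrt_le_mono) simp
  then have sn: "10 \<le> sqrt (real n)" by simp
  then have "0 < 1 / sqrt (real n)" using n by simp
  then have tt: "t < t'" using t by linarith
  show "0 < s" unfolding s_def using tt n by simp
  have "(8 / 5) * pi * (t' - t) \<le> (8 / 5) * 4 * (1 / 12)"
    using t tt pi_less_4 by (intro mult_mono) auto
  then have "s \<le> ((8 / 5) * 4 * (1 / 12)) / 10"
    unfolding s_def using sn tt by (intro frac_le) auto
  then show "s \<le> 1 / 8" by simp
  have "1 \<le> (t' - t) * sqrt (real n)" using t(3) n by (simp add: divide_le_eq)
  then have "2 * 1 \<le> pi * ((t' - t) * sqrt (real n))"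
    by (intro mult_mono) (use pi_ge_two in auto)
  moreover have "s * real n = (8 / 5) * (pi * ((t' - t) * sqrt (real n)))"
  proof -
    have "s * real n = (8 / 5) * pi * (t' - t) * (real n / sqrt (real n))" by (simp add: s_def)
    then show ?thesis by (simp only: real_div_sqrt of_nat_0_le_iff mult.assoc)
  qed
  ultimately show "3 \<le> 2 * s * real n" by simp
  show "s \<le> (\<Sum>k<Suc k. wave (t' + real k)) - (\<Sum>k<Suc k. wave (t + real k))
        - ((\<Sum>k<k. wave (t' + real k)) - (\<Sum>k<k. wave (t + real k))) \<and>
      (\<Sum>k<Suc k. wave (t' + real k)) - (\<Sum>k<Suc k. wave (t + real k))
        - ((\<Sum>k<k. wave (t' + real k)) - (\<Sum>k<k. wave (t + real k))) \<le> 2 * s"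
    if "n \<le> 2 * k" "k < n" for k
    using wave_diff_bounds[OF t(1) tt t(2) n that] unfolding s_def by simp
qed (use n in simp)

section \<open>Orbits of the skew product and the count of separated points\<close>

abbreviation example_map :: "real \<Rightarrow> real \<times> circle \<Rightarrow> real \<times> circle" where
  "example_map \<rho> \<equiv> skew_product slow_map (\<lambda>x. circle_of (oscillation x)) \<rho>"

text \<open>For \<open>t \<ge> 2\<close> the base acts as a shift and the fibre accumulates a sum of
  \<open>wave\<close>. The rotation term is the same for all starting points and cancels in
  differences.\<close>

lemma example_map_funpow:
  assumes "2 \<le> t"
  shows "(example_map \<rho> ^^ k) (t powr (- 1 / 4), circle_of y) =
    ((t + real k) powr (- 1 / 4), circle_of (y + (\<Sum>i<k. wave (t + real i)) + real k * \<rho>))"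
proof (induction k)
  case (Suc k)
  have "2 \<le> t + real k" using assms by simp
  note step = slow_map_powr[OF this] oscillation_powr[OF this]
  have "(example_map \<rho> ^^ Suc k) (t powr (- 1 / 4), circle_of y) =
      example_map \<rho> ((t + real k) powr (- 1 / 4), circle_of (y + (\<Sum>i<k. wave (t + real i)) + real k * \<rho>))"
    unfolding funpow.simps o_apply Suc ..
  also have "\<dots> = ((t + real k + 1) powr (- 1 / 4),
      circle_of (y + (\<Sum>i<k. wave (t + real i)) + real k * \<rho> + wave (t + real k) + \<rho>))"
    unfolding skew_product_def prod.case step circle_of_add ..
  finally show ?case by (simp add: algebra_simps)
qed simp

text \<open>\<open>max_dist\<close> dominates the fibre distance, which already suffices.\<close>

lemma hamming_dist_example_map_ge:
  assumes t: "13 / 6 \<le> t" "t' \<le> 9 / 4" "1 / sqrt (real n) \<le> t' - t" and n: "100 \<le> n"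
  shows "1 / 64 \<le> hamming_dist max_dist (example_map \<rho>) n
    (t' powr (- 1 / 4), circle_of 0) (t powr (- 1 / 4), circle_of 0)"
proof -
  have "0 \<le> 1 / sqrt (real n)" by simp
  then have two: "2 \<le> t" "2 \<le> t'" using t by linarith+
  have "real n / 64 \<le> (\<Sum>i<n. dist_Ints ((\<Sum>k<i. wave (t' + real k)) - (\<Sum>k<i. wave (t + real k))))"
    by (rule sum_dist_Ints_wave_ge[OF t n])
  also have "\<dots> \<le> (\<Sum>i<n. max_dist ((example_map \<rho> ^^ i) (t' powr (- 1 / 4), circle_of 0))
      ((example_map \<rho> ^^ i) (t powr (- 1 / 4), circle_of 0)))"
    unfolding example_map_funpow[OF two(1)] example_map_funpow[OF two(2)]
    by (intro sum_mono) (simp add: max_dist_def dist_circle_of)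
  finally show ?thesis using n unfolding hamming_dist_def by (simp add: field_simps)
qed

lemma slow_map_image: "slow_map ` {0..1} = {0..1}"
  using diffeomorphism_on_slow_map by (simp add: diffeomorphism_on_def bij_betw_def)

lemma example_map_image: "example_map \<rho> ` ({0..1} \<times> UNIV) \<subseteq> {0..1} \<times> UNIV"
  using slow_map_image by (auto simp: skew_product_def)

lemma continuous_on_example_map: "continuous_on ({0..1} \<times> UNIV) (example_map \<rho>)"
proof -
  have "continuous_on {0..1} slow_map"
    using diffeomorphism_on_slow_map DERIV_continuous_on
    unfolding diffeomorphism_on_def C1_on_def by metis
  moreover have "continuous_on {0..1} oscillation"
  proof (intro continuous_at_imp_continuous_on ballI)
    fix x :: real assume "x \<in> {0..1}"
    then show "isCont oscillation x" using oscillation_differentiable[of x] DERIV_isCont by auto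
  qed
  moreover have "continuous_on ({0..1} \<times> UNIV) (\<lambda>p. g (fst p))"
    if "continuous_on {0..1} g" for g :: "real \<Rightarrow> real"
    by (rule continuous_on_compose2[OF that continuous_on_fst[OF continuous_on_id]]) auto
  ultimately have "continuous_on ({0..1} \<times> UNIV) (\<lambda>p. slow_map (fst p))"
    "continuous_on ({0..1} \<times> UNIV) (\<lambda>p. oscillation (fst p))" by blast+
  then show ?thesis
    unfolding skew_product_def case_prod_beta by (intro continuous_intros)
qed

lemma hamming_sep_card_example_map_ge:
  assumes n: "100 \<le> n"
  shows "sqrt (real n) / 12 \<le>
    real (hamming_sep_card ({0..1} \<times> UNIV) max_dist (example_map \<rho>) n (1 / 64))"
proof -
  let ?X = "{0..1} \<times> UNIV :: (real \<times> circle) set"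
  define r where "r = sqrt (real n)"
  have r: "r > 0" using n by (simp add: r_def)
  \<comment> \<open>The interval from \<open>13 / 6\<close> to \<open>9 / 4\<close> has length
    \<open>1 / 12\<close>, so it holds the points with gap \<open>1 / r\<close> up to this index.
    Including index 0 makes their number at least \<open>r / 12\<close>.\<close>
  define J where "J = {..nat \<lfloor>r / 12\<rfloor>}"
  define t where "t j = 13 / 6 + real j / r" for j
  define p where "p j = (t j powr (- 1 / 4), circle_of 0)" for j
  have t: "13 / 6 \<le> t j" "t j \<le> 9 / 4" if "j \<in> J" for j
  proof -
    have "real j \<le> r / 12" using that r unfolding J_def by simp linarith
    then show "13 / 6 \<le> t j" "t j \<le> 9 / 4" using r unfolding t_def by (simp_all add: field_simps)
  qed
  have sep': "1 / 64 \<le> hamming_dist max_dist (example_map \<rho>) n (p j) (p i)"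
    if "i \<in> J" "j \<in> J" "i < j" for i j
    unfolding p_def
  proof (rule hamming_dist_example_map_ge)
    have "1 / r \<le> (real j - real i) / r" using that r by (intro divide_right_mono) auto
    then show "1 / sqrt (real n) \<le> t j - t i" by (simp add: t_def r_def diff_divide_distrib)
  qed (use t that n in auto)
  have sep: "1 / 64 \<le> hamming_dist max_dist (example_map \<rho>) n (p j) (p i)"
    if "i \<in> J" "j \<in> J" "i \<noteq> j" for i j
    using that sep'[of i j] sep'[of j i] hamming_dist_commute[of "example_map \<rho>" n "p i" "p j"]
    by (cases "i < j") auto
  \<comment> \<open>Equal points would have Hamming distance 0, contradicting
    \<open>sep\<close>.\<close>
  have "inj_on p J"
  proof (rule inj_onI, rule ccontr)
    fix i j assume "i \<in> J" "j \<in> J" "p i = p j" "i \<noteq> j"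
    then show False using sep[of i j] by (simp add: hamming_dist_def max_dist_def)
  qed
  then have card: "card (p ` J) = nat \<lfloor>r / 12\<rfloor> + 1" by (simp add: card_image J_def)
  have X: "compact ?X" by (intro compact_Times compact_UNIV_circle) simp
  have "card (p ` J) \<le> hamming_sep_card ?X max_dist (example_map \<rho>) n (1 / 64)"
  proof (rule hamming_sep_card_ge)
    show "finite {card S | S. S \<subseteq> ?X \<and> finite S \<and> hamming_separated max_dist (example_map \<rho>) n (1 / 64) S}"
      by (rule bounded_hamming_separated[OF X continuous_on_example_map example_map_image max_dist_le_dist]) simp
    have "t j powr (- 1 / 4) \<le> 1" if "j \<in> J" for j
      using t[OF that] powr_mono[of "- 1 / 4" 0 "t j"] by simp
    then show "p ` J \<subseteq> ?X" by (auto simp: p_def)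
    show "hamming_separated max_dist (example_map \<rho>) n (1 / 64) (p ` J)"
      unfolding hamming_separated_def using sep by blast
  qed (simp add: J_def)
  then have "real (nat \<lfloor>r / 12\<rfloor> + 1) \<le> real (hamming_sep_card ?X max_dist (example_map \<rho>) n (1 / 64))"
    unfolding card by (simp only: of_nat_le_iff)
  moreover have "r / 12 \<le> real (nat \<lfloor>r / 12\<rfloor> + 1)" by linarith
  ultimately show ?thesis unfolding r_def by linarith
qed

text \<open>The count \<open>sqrt n / 12\<close> gives exponent \<open>1 / 2\<close>; the constant
  contributes only \<open>ln 12 / ln n\<close>, which tends to 0.\<close>

lemma lower_modified_power_entropy_example_map:
  "ereal (1 / 2) \<le> lower_modified_power_entropy ({0..1} \<times> UNIV) max_dist (example_map \<rho>)"
proof -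
  let ?X = "{0..1} \<times> UNIV :: (real \<times> circle) set"
  let ?N = "\<lambda>n. hamming_sep_card ?X max_dist (example_map \<rho>) n (1 / 64)"
  have "filterlim (\<lambda>n. ln (real n)) at_infinity sequentially"
    by (intro filterlim_at_top_imp_at_infinity filterlim_compose[OF ln_at_top filterlim_real_sequentially])
  then have "(\<lambda>n. 1 / 2 - ln 12 / ln (real n)) \<longlonglongrightarrow> 1 / 2 - 0"
    by (intro tendsto_diff tendsto_const tendsto_divide_0[OF tendsto_const])
  then have "(\<lambda>n. ereal (1 / 2 - ln 12 / ln (real n))) \<longlonglongrightarrow> ereal (1 / 2)"
    by (simp only: lim_ereal diff_zero)
  then have "ereal (1 / 2) = liminf (\<lambda>n. ereal (1 / 2 - ln 12 / ln (real n)))"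
    using lim_imp_Liminf[OF trivial_limit_sequentially] by metis
  also have "\<dots> \<le> liminf (\<lambda>n. ereal (ln (real (?N n)) / ln (real n)))"
  proof (rule Liminf_mono)
    have "\<forall>\<^sub>F n in sequentially. 100 \<le> n" by (rule eventually_ge_at_top)
    then show "\<forall>\<^sub>F n in sequentially. ereal (1 / 2 - ln 12 / ln (real n))
        \<le> ereal (ln (real (?N n)) / ln (real n))"
    proof eventually_elim
      case (elim n)
      have "0 < sqrt (real n) / 12" using elim by simp
      then have "ln (sqrt (real n) / 12) \<le> ln (real (?N n))"
        using hamming_sep_card_example_map_ge[OF elim] by (intro ln_mono) auto
      then have "ln (sqrt (real n) / 12) / ln (real n) \<le> ln (real (?N n)) / ln (real n)"
        using elim by (intro divide_right_mono) auto
      moreover have "ln (sqrt (real n) / 12) / ln (real n) = 1 / 2 - ln 12 / ln (real n)"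
        using elim by (simp add: ln_div ln_sqrt diff_divide_distrib)
      ultimately show ?case by simp
    qed
  qed
  also have "\<dots> \<le> lower_modified_power_entropy ?X max_dist (example_map \<rho>)"
    by (rule liminf_le_lower_modified_power_entropy[OF _ _ continuous_on_example_map
          example_map_image max_dist_le_dist])
      (auto intro!: compact_Times compact_UNIV_circle)
  finally show ?thesis .
qed

theorem theorem5p1:
  shows "\<exists>(f :: real \<times> circle \<Rightarrow> real \<times> circle) (\<tau> :: real \<Rightarrow> real) (\<beta> :: real \<Rightarrow> circle) (\<rho> :: real).
    (\<forall>p \<in> {0..1} \<times> UNIV. f p = skew_product \<tau> \<beta> \<rho> p) \<and>
    \<rho> \<notin> \<rat> \<and>
    diffeomorphism_on {0..1} \<tau> \<and>
    {x \<in> {0..1}. \<tau> x = x} = {0, 1} \<and>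
    circle_differentiable_on \<beta> {0..1} \<and>
    (\<exists>\<epsilon>>0. \<forall>x \<in> {0} \<union> (ball 1 \<epsilon> \<inter> {0..1}). \<beta> x = 0) \<and>
    lower_modified_power_entropy ({0..1} \<times> UNIV) max_dist f \<ge> ereal (1 / 2)"
proof -
  obtain \<rho> :: real where \<rho>: "\<rho> \<notin> \<rat>"
    using countable_rat uncountable_UNIV_real by (metis UNIV_eq_I)
  have "circle_differentiable_on (\<lambda>x. circle_of (oscillation x)) {0..1}"
    unfolding circle_differentiable_on_def
  proof
    fix x :: real assume "x \<in> {0..1}"
    then obtain D where "(oscillation has_real_derivative D) (at x)"
      using oscillation_differentiable[of x] by auto
    then have "oscillation differentiable at x within {0..1}"
      unfolding real_differentiable_def using has_field_derivative_at_within by blast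
    then show "\<exists>U b. open U \<and> x \<in> U \<and> (\<forall>y\<in>{0..1} \<inter> U. circle_of (oscillation y) = circle_of (b y)) \<and>
        b differentiable at x within {0..1}"
      by (intro exI[of _ UNIV] exI[of _ oscillation]) auto
  qed
  \<comment> \<open>The radius \<open>1 / 10\<close> works because
    \<open>(9 / 10) ^ 4 > 1 / 2\<close>, beyond the cut.\<close>
  moreover have "oscillation x = 0" if "x \<in> {0} \<union> (ball 1 (1 / 10) \<inter> {0..1})" for x
  proof -
    have "\<not> x ^ 4 \<le> 1 / 2" if "9 / 10 \<le> x"
      using power_mono[OF that, of 4] by (simp add: power_numeral_reduce)
    then show ?thesis using that by (auto simp: oscillation_def dist_real_def)
  qed
  then have "\<forall>x \<in> {0} \<union> (ball 1 (1 / 10) \<inter> {0..1}). circle_of (oscillation x) = 0"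
    by (auto simp: zero_circle_def)
  ultimately show ?thesis
    using \<rho> diffeomorphism_on_slow_map slow_map_fixed_points lower_modified_power_entropy_example_map
    by (intro exI[of _ "example_map \<rho>"] exI[of _ slow_map] exI[of _ "\<lambda>x. circle_of (oscillation x)"]
        exI[of _ \<rho>] conjI exI[of _ "1 / 10"]) auto
qed

end
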